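(* Let $G$ be a linear algebraic group over an algebraically closed field $\Bbbk$, and let $N$ be a closed normal subgroup of $G$ such that $G/N$ is reductive. Then for any $G$-module $V$, we have $$\delta(G,V)\le \delta(N,V)\,\delta(G/N)\le \delta(N)\,\delta(G/N),$$ so in particular we have $\delta(G)\le \delta(N)\,\delta(G/N)$.
   Context: For a linear algebraic group $G$ over $\Bbbk$, a $G$-module is a finite-dimensional rational representation $V$ of $G$ over $\Bbbk$; a $G$-module is viewed as an $N$-module by restriction. $\Bbbk[V]\cong S(V^* )$ is the ring of polynomial functions on $V$, with $G$-action $(g\cdot f)(v)=f(g^{-1}v)$ and invariant ring $\Bbbk[V]^G$, graded by degree. $\Bbbk[V]^G_{\le d}$ is the set of invariants of degree at most $d$. For $S\subseteq \Bbbk[V]$, $S_+$ is the set of elements of $S$ with constant term zero. The nullcone $\mathcal{N}_{G,V}\subseteq V$ is the common zero set of $\Bbbk[V]^G_+$. A subset $S\subseteq\Bbbk[V]^G$ is a $\delta$-set if for every $v\in V^G\setminus\mathcal{N}_{G,V}$ there is $f\in S_+$ with $f(v)\neq 0$. Define $\delta(G,V)=\min\{d\ge 0 : \Bbbk[V]^G_{\le d}\text{ is a }\delta\text{-set}\}$ and $\delta(G)=\sup\{\delta(G,V): V\text{ a }G\text{-module}\}$, where the supremum of an unbounded set is taken to be infinity. The same definitions apply to the groups $N$ and $G/N$. Reductive is used in the sense of geometrically reductive: for every module $V$ of the group and every nonzero fixed vector $v\in V$ there is an invariant $f\in\Bbbk[V]$ with constant term zero and $f(v)\ne0$. *)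

theory Defs
  imports
    "HOL-Algebra.Coset"
    "HOL-Computational_Algebra.Polynomial"
    "HOL-Library.Extended_Nat"
    "HOL-Library.FuncSet"
    "Jordan_Normal_Form.Matrix"
begin

section \<open>Affine varieties and linear algebraic groups\<close>

text \<open>
  A variety is given by its set of points together with its ring of regular functions. Functions
  on a set \<open>X\<close> are \<open>extensional\<close>, so that equality of functions is equality on \<open>X\<close>.
\<close>

definition function_algebra :: "'a set \<Rightarrow> ('a \<Rightarrow> 'k::field) set \<Rightarrow> bool" where
  "function_algebra X A \<longleftrightarrow>
     A \<subseteq> extensional X \<and>
     (\<forall>c. (\<lambda>x\<in>X. c) \<in> A) \<and>
     (\<forall>f\<in>A. \<forall>h\<in>A. (\<lambda>x\<in>X. f x + h x) \<in> A) \<and>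
     (\<forall>f\<in>A. \<forall>h\<in>A. (\<lambda>x\<in>X. f x * h x) \<in> A)"

definition algebra_hom_to_field :: "'a set \<Rightarrow> ('a \<Rightarrow> 'k::field) set \<Rightarrow> (('a \<Rightarrow> 'k) \<Rightarrow> 'k) \<Rightarrow> bool" where
  "algebra_hom_to_field X A \<phi> \<longleftrightarrow>
     (\<forall>c. \<phi> (\<lambda>x\<in>X. c) = c) \<and>
     (\<forall>f\<in>A. \<forall>h\<in>A. \<phi> (\<lambda>x\<in>X. f x + h x) = \<phi> f + \<phi> h) \<and>
     (\<forall>f\<in>A. \<forall>h\<in>A. \<phi> (\<lambda>x\<in>X. f x * h x) = \<phi> f * \<phi> h)"

text \<open>
  \<open>A\<close> is a finitely generated algebra of functions on \<open>X\<close> (hence reduced), and evaluation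
  identifies the points of \<open>X\<close> with the algebra homomorphisms from \<open>A\<close> to the field, that is,
  with the maximal spectrum of \<open>A\<close> when the field is algebraically closed.
\<close>

definition affine_variety :: "'a set \<Rightarrow> ('a \<Rightarrow> 'k::field) set \<Rightarrow> bool" where
  "affine_variety X A \<longleftrightarrow>
     function_algebra X A \<and>
     (\<exists>F. finite F \<and> F \<subseteq> A \<and> (\<forall>B. function_algebra X B \<and> F \<subseteq> B \<longrightarrow> A \<subseteq> B)) \<and>
     (\<forall>x\<in>X. \<forall>y\<in>X. (\<forall>f\<in>A. f x = f y) \<longrightarrow> x = y) \<and>
     (\<forall>\<phi>. algebra_hom_to_field X A \<phi> \<longrightarrow> (\<exists>x\<in>X. \<forall>f\<in>A. \<phi> f = f x))"

record ('g, 'k) alg_grp = "'g monoid" +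
  coord_ring :: "('g \<Rightarrow> 'k) set"

text \<open>
  Inversion and multiplication are morphisms of varieties; for multiplication, \<open>f(xy)\<close> has to be a
  regular function on the product, i.e. an element of the tensor square of the coordinate ring.
\<close>

definition linear_algebraic_group :: "('g, 'k::field) alg_grp \<Rightarrow> bool" where
  "linear_algebraic_group G \<longleftrightarrow>
     group G \<and>
     affine_variety (carrier G) (coord_ring G) \<and>
     (\<forall>f\<in>coord_ring G. (\<lambda>x\<in>carrier G. f (inv\<^bsub>G\<^esub> x)) \<in> coord_ring G) \<and>
     (\<forall>f\<in>coord_ring G. \<exists>r a b.
        (\<forall>i<(r::nat). a i \<in> coord_ring G \<and> b i \<in> coord_ring G) \<and>
        (\<forall>x\<in>carrier G. \<forall>y\<in>carrier G. f (x \<otimes>\<^bsub>G\<^esub> y) = (\<Sum>i<r. a i x * b i y)))"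

definition zariski_closed :: "('g, 'k::field) alg_grp \<Rightarrow> 'g set \<Rightarrow> bool" where
  "zariski_closed G Z \<longleftrightarrow>
     (\<exists>I. I \<subseteq> coord_ring G \<and> Z = {x \<in> carrier G. \<forall>f\<in>I. f x = 0})"

text \<open>The regular functions on a closed subgroup are the restrictions of those on \<open>G\<close>.\<close>

definition closed_subgrp :: "('g, 'k::field) alg_grp \<Rightarrow> 'g set \<Rightarrow> ('g, 'k) alg_grp" where
  "closed_subgrp G N = G\<lparr>carrier := N, coord_ring := (\<lambda>f. restrict f N) ` coord_ring G\<rparr>"

text \<open>
  For a closed normal subgroup \<open>N\<close>, the regular functions on the quotient variety \<open>G/N\<close> are the
  functions on the set of cosets whose pullback to \<open>G\<close> is regular.
\<close>

definition quotient_grp :: "('g, 'k::field) alg_grp \<Rightarrow> 'g set \<Rightarrow> ('g set, 'k) alg_grp" where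
  "quotient_grp G N =
     \<lparr>carrier = carrier (G Mod N), monoid.mult = monoid.mult (G Mod N), one = one (G Mod N),
      coord_ring = {f \<in> extensional (carrier (G Mod N)).
                      (\<lambda>x\<in>carrier G. f (N #>\<^bsub>G\<^esub> x)) \<in> coord_ring G}\<rparr>"


section \<open>Modules and invariants\<close>

text \<open>
  A \<open>G\<close>-module is given in coordinates, by its dimension \<open>n\<close> and its matrix representation \<open>\<rho>\<close>;
  the underlying vector space is \<open>carrier_vec n\<close>.
\<close>

definition rational_rep :: "('g, 'k::field) alg_grp \<Rightarrow> nat \<Rightarrow> ('g \<Rightarrow> 'k mat) \<Rightarrow> bool" where
  "rational_rep G n \<rho> \<longleftrightarrow>
     (\<forall>x\<in>carrier G. \<rho> x \<in> carrier_mat n n) \<and>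
     \<rho> \<one>\<^bsub>G\<^esub> = 1\<^sub>m n \<and>
     (\<forall>x\<in>carrier G. \<forall>y\<in>carrier G. \<rho> (x \<otimes>\<^bsub>G\<^esub> y) = \<rho> x * \<rho> y) \<and>
     (\<forall>i<n. \<forall>j<n. (\<lambda>x\<in>carrier G. \<rho> x $$ (i, j)) \<in> coord_ring G)"

definition exponents :: "nat \<Rightarrow> nat \<Rightarrow> (nat \<Rightarrow> nat) set" where
  "exponents n d = {\<alpha>. (\<forall>i\<ge>n. \<alpha> i = 0) \<and> (\<Sum>i<n. \<alpha> i) \<le> d}"

lemma finite_exponents: "finite (exponents n d)"
proof (rule finite_subset)
  show "exponents n d \<subseteq> {\<alpha>. \<forall>i. (i \<in> {..<n} \<longrightarrow> \<alpha> i \<in> {..d}) \<and> (i \<notin> {..<n} \<longrightarrow> \<alpha> i = 0)}"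
  proof
    fix \<alpha> assume *: "\<alpha> \<in> exponents n d"
    have "\<alpha> i \<le> d" if "i < n" for i
    proof -
      have "\<alpha> i \<le> (\<Sum>i<n. \<alpha> i)"
        using that by (intro member_le_sum) auto
      then show ?thesis
        using * by (simp add: exponents_def)
    qed
    then show "\<alpha> \<in> {\<alpha>. \<forall>i. (i \<in> {..<n} \<longrightarrow> \<alpha> i \<in> {..d}) \<and> (i \<notin> {..<n} \<longrightarrow> \<alpha> i = 0)}"
      using * by (auto simp: exponents_def)
  qed
  show "finite {\<alpha>. \<forall>i. (i \<in> {..<n} \<longrightarrow> \<alpha> i \<in> {..d}) \<and> (i \<notin> {..<n} \<longrightarrow> \<alpha> i = (0::nat))}"
    by (rule finite_set_of_finite_funs) auto
qed

text \<open>
  Over an infinite field a polynomial function has a unique polynomial representing it, so its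
  degree is meaningful and its constant term is its value at \<open>0\<close>.
\<close>

definition poly_funs_le :: "nat \<Rightarrow> nat \<Rightarrow> ('k::field vec \<Rightarrow> 'k) set" where
  "poly_funs_le n d =
     {\<lambda>v\<in>carrier_vec n. \<Sum>\<alpha>\<in>exponents n d. c \<alpha> * (\<Prod>i<n. v $ i ^ \<alpha> i) | c. True}"

definition poly_funs :: "nat \<Rightarrow> ('k::field vec \<Rightarrow> 'k) set" where
  "poly_funs n = (\<Union>d. poly_funs_le n d)"

definition act :: "('g, 'k::field) alg_grp \<Rightarrow> nat \<Rightarrow> ('g \<Rightarrow> 'k mat) \<Rightarrow> 'g \<Rightarrow> ('k vec \<Rightarrow> 'k) \<Rightarrow> ('k vec \<Rightarrow> 'k)"
  where "act G n \<rho> x f = (\<lambda>v\<in>carrier_vec n. f (\<rho> (inv\<^bsub>G\<^esub> x) *\<^sub>v v))"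

definition invariants :: "('g, 'k::field) alg_grp \<Rightarrow> nat \<Rightarrow> ('g \<Rightarrow> 'k mat) \<Rightarrow> ('k vec \<Rightarrow> 'k) set" where
  "invariants G n \<rho> = {f \<in> poly_funs n. \<forall>x\<in>carrier G. act G n \<rho> x f = f}"

definition invariants_le ::
    "('g, 'k::field) alg_grp \<Rightarrow> nat \<Rightarrow> ('g \<Rightarrow> 'k mat) \<Rightarrow> nat \<Rightarrow> ('k vec \<Rightarrow> 'k) set" where
  "invariants_le G n \<rho> d = invariants G n \<rho> \<inter> poly_funs_le n d"

definition zero_const :: "nat \<Rightarrow> ('k::field vec \<Rightarrow> 'k) set \<Rightarrow> ('k vec \<Rightarrow> 'k) set" where
  "zero_const n S = {f \<in> S. f (0\<^sub>v n) = 0}"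

definition fixed_points :: "('g, 'k::field) alg_grp \<Rightarrow> nat \<Rightarrow> ('g \<Rightarrow> 'k mat) \<Rightarrow> 'k vec set" where
  "fixed_points G n \<rho> = {v \<in> carrier_vec n. \<forall>x\<in>carrier G. \<rho> x *\<^sub>v v = v}"

definition nullcone :: "('g, 'k::field) alg_grp \<Rightarrow> nat \<Rightarrow> ('g \<Rightarrow> 'k mat) \<Rightarrow> 'k vec set" where
  "nullcone G n \<rho> = {v \<in> carrier_vec n. \<forall>f\<in>zero_const n (invariants G n \<rho>). f v = 0}"

definition geometrically_reductive :: "('g, 'k::field) alg_grp \<Rightarrow> bool" where
  "geometrically_reductive G \<longleftrightarrow>
     (\<forall>n \<rho>. rational_rep G n \<rho> \<longrightarrow>
        (\<forall>v\<in>fixed_points G n \<rho> - {0\<^sub>v n}. \<exists>f\<in>zero_const n (invariants G n \<rho>). f v \<noteq> 0))"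


section \<open>Delta-sets and the delta-number\<close>

definition delta_set ::
    "('g, 'k::field) alg_grp \<Rightarrow> nat \<Rightarrow> ('g \<Rightarrow> 'k mat) \<Rightarrow> ('k vec \<Rightarrow> 'k) set \<Rightarrow> bool" where
  "delta_set G n \<rho> S \<longleftrightarrow>
     S \<subseteq> invariants G n \<rho> \<and>
     (\<forall>v\<in>fixed_points G n \<rho> - nullcone G n \<rho>. \<exists>f\<in>zero_const n S. f v \<noteq> 0)"

text \<open>
  In \<^typ>\<open>enat\<close> the infimum of a nonempty set is its minimum (and the infimum of the empty set
  would be \<open>\<infinity>\<close>).
\<close>

definition delta_rep :: "('g, 'k::field) alg_grp \<Rightarrow> nat \<Rightarrow> ('g \<Rightarrow> 'k mat) \<Rightarrow> enat" where
  "delta_rep G n \<rho> = Inf {enat d | d. delta_set G n \<rho> (invariants_le G n \<rho> d)}"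

definition delta :: "('g, 'k::field) alg_grp \<Rightarrow> enat" where
  "delta G = Sup {delta_rep G n \<rho> | n \<rho>. rational_rep G n \<rho>}"

end

theory Submission
  imports Defs
begin

text \<open>
  Let \<open>v\<close> be a \<open>G\<close>-fixed point outside the nullcone and let \<open>d = \<delta>(N, V)\<close>. The \<open>N\<close>-invariants of
  degree at most \<open>d\<close> without constant term form a finite-dimensional \<open>G\<close>-module \<open>W\<close> on which \<open>N\<close>
  acts trivially, and some element of \<open>W\<close> does not vanish at \<open>v\<close>. Evaluation at \<open>v\<close> is thus a nonzero
  fixed point of the \<open>G/N\<close>-module \<open>W\<^sup>*\<close>, so, \<open>G/N\<close> being reductive, it is separated from \<open>0\<close> by an
  invariant \<open>F\<close> of degree at most \<open>\<delta>(G/N)\<close>. Pulling \<open>F\<close> back along the evaluation map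
  \<open>V \<rightarrow> W\<^sup>*\<close> gives a \<open>G\<close>-invariant of degree at most \<open>d \<delta>(G/N)\<close> that does not vanish at \<open>v\<close>.

  The matrix of \<open>G/N\<close> on \<open>W\<^sup>*\<close> becomes explicit, and its entries visibly regular, in a basis \<open>b\<^sub>i\<close> of
  \<open>W\<close> with points \<open>u\<^sub>j\<close> such that \<open>b\<^sub>i(u\<^sub>j) = \<delta>\<^sub>i\<^sub>j\<close>: the \<open>(i, j)\<close> entry at \<open>x\<close> is \<open>b\<^sub>i(x u\<^sub>j)\<close>.
\<close>

section \<open>Polynomial functions\<close>

text \<open>Values outside \<open>carrier_vec n\<close> are left free, so that closure properties
  can be stated for plain lambda terms; \<open>poly_funs_le\<close> in addition demands
  extensionality.\<close>

definition poly_on :: "nat \<Rightarrow> nat \<Rightarrow> ('k::field vec \<Rightarrow> 'k) \<Rightarrow> bool" where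
  "poly_on n d f \<longleftrightarrow>
     (\<exists>c. \<forall>v\<in>carrier_vec n. f v = (\<Sum>\<alpha>\<in>exponents n d. c \<alpha> * (\<Prod>i<n. v $ i ^ \<alpha> i)))"

lemma restrict_poly_funs_le_iff:
  "restrict f (carrier_vec n) \<in> poly_funs_le n d \<longleftrightarrow> poly_on n d f"
proof -
  have "restrict f X = restrict g X \<longleftrightarrow> (\<forall>v\<in>X. f v = g v)" for X and g :: "'a vec \<Rightarrow> 'a"
    by (auto simp: restrict_def fun_eq_iff)
  then show ?thesis
    by (simp add: poly_funs_le_def poly_on_def)
qed

lemma poly_funs_le_iff:
  "f \<in> poly_funs_le n d \<longleftrightarrow> f \<in> extensional (carrier_vec n) \<and> poly_on n d f"
proof -
  have "f \<in> extensional (carrier_vec n)" if "f \<in> poly_funs_le n d"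
    using that by (auto simp: poly_funs_le_def)
  then show ?thesis
    by (metis restrict_poly_funs_le_iff extensional_restrict)
qed

lemma poly_on_cong:
  "(\<And>v. v \<in> carrier_vec n \<Longrightarrow> f v = g v) \<Longrightarrow> poly_on n d f \<longleftrightarrow> poly_on n d g"
  by (simp add: poly_on_def)

lemma poly_on_monomial:
  assumes "\<alpha> \<in> exponents n d"
  shows "poly_on n d (\<lambda>v. c * (\<Prod>i<n. v $ i ^ \<alpha> i))"
  unfolding poly_on_def
proof (intro exI ballI)
  fix v :: "'a vec"
  have "(\<Sum>\<beta>\<in>exponents n d. (if \<beta> = \<alpha> then c else 0) * (\<Prod>i<n. v $ i ^ \<beta> i))
        = (\<Sum>\<beta>\<in>exponents n d. if \<beta> = \<alpha> then c * (\<Prod>i<n. v $ i ^ \<beta> i) else 0)"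
    by (rule sum.cong) auto
  then show "c * (\<Prod>i<n. v $ i ^ \<alpha> i)
      = (\<Sum>\<beta>\<in>exponents n d. (if \<beta> = \<alpha> then c else 0) * (\<Prod>i<n. v $ i ^ \<beta> i))"
    using assms by (simp add: finite_exponents)
qed

lemma poly_on_0: "poly_on n d (\<lambda>v. 0)"
  unfolding poly_on_def by (rule exI[of _ "\<lambda>_. 0"]) simp

lemma poly_on_const: "poly_on n d (\<lambda>v. c)"
  using poly_on_monomial[of "\<lambda>_. 0" n d c] by (simp add: exponents_def)

lemma poly_on_add:
  assumes "poly_on n d f" "poly_on n d g"
  shows "poly_on n d (\<lambda>v. f v + g v)"
proof -
  obtain a b where
    "\<forall>v\<in>carrier_vec n. f v = (\<Sum>\<alpha>\<in>exponents n d. a \<alpha> * (\<Prod>i<n. v $ i ^ \<alpha> i))"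
    "\<forall>v\<in>carrier_vec n. g v = (\<Sum>\<alpha>\<in>exponents n d. b \<alpha> * (\<Prod>i<n. v $ i ^ \<alpha> i))"
    using assms unfolding poly_on_def by blast
  then show ?thesis
    unfolding poly_on_def
    by (intro exI[of _ "\<lambda>\<alpha>. a \<alpha> + b \<alpha>"]) (simp add: algebra_simps sum.distrib)
qed

lemma poly_on_sum:
  "(\<And>i. i \<in> I \<Longrightarrow> poly_on n d (f i)) \<Longrightarrow> poly_on n d (\<lambda>v. \<Sum>i\<in>I. f i v)"
  by (induction I rule: infinite_finite_induct) (auto intro: poly_on_0 poly_on_add)

lemma poly_on_mult:
  assumes "poly_on n d f" "poly_on n e g"
  shows "poly_on n (d + e) (\<lambda>v. f v * g v)"
proof -
  obtain a b where
    ab: "\<forall>v\<in>carrier_vec n. f v = (\<Sum>\<alpha>\<in>exponents n d. a \<alpha> * (\<Prod>i<n. v $ i ^ \<alpha> i))"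
    "\<forall>v\<in>carrier_vec n. g v = (\<Sum>\<beta>\<in>exponents n e. b \<beta> * (\<Prod>i<n. v $ i ^ \<beta> i))"
    using assms unfolding poly_on_def by blast
  have "poly_on n (d + e) (\<lambda>v. \<Sum>\<alpha>\<in>exponents n d. \<Sum>\<beta>\<in>exponents n e.
          (a \<alpha> * b \<beta>) * (\<Prod>i<n. v $ i ^ (\<alpha> i + \<beta> i)))"
    by (intro poly_on_sum poly_on_monomial)
       (auto simp: exponents_def sum.distrib intro: add_mono)
  then show ?thesis
    by (rule poly_on_cong[THEN iffD1, rotated])
       (simp add: ab sum_product power_add prod.distrib algebra_simps)
qed

text \<open>Multiplying by the constant 1, counted as a polynomial of degree at most
  \<open>e - d\<close>, raises the bound without any reindexing of coefficients.\<close>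

lemma poly_on_mono:
  assumes "poly_on n d f" "d \<le> e"
  shows "poly_on n e f"
  using poly_on_mult[OF assms(1) poly_on_const[of n "e - d" 1]] assms(2) by simp

lemma poly_on_power: "poly_on n d f \<Longrightarrow> poly_on n (k * d) (\<lambda>v. f v ^ k)"
  by (induction k) (auto intro: poly_on_const poly_on_mult)

lemma poly_on_prod:
  "finite I \<Longrightarrow> (\<And>i. i \<in> I \<Longrightarrow> poly_on n (d i) (f i))
     \<Longrightarrow> poly_on n (\<Sum>i\<in>I. d i) (\<lambda>v. \<Prod>i\<in>I. f i v)"
  by (induction I rule: finite_induct) (auto intro: poly_on_const poly_on_mult)

lemma poly_on_coordinate:
  assumes "i < n"
  shows "poly_on n 1 (\<lambda>v. v $ i)"
proof -
  have "(\<Prod>j<n. v $ j ^ (if j = i then 1 else 0)) = v $ i" for v :: "'a vec"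
  proof -
    have "(\<Prod>j<n. v $ j ^ (if j = i then 1 else 0 :: nat)) = (\<Prod>j<n. if j = i then v $ j else 1)"
      by (rule prod.cong) auto
    then show ?thesis using assms by simp
  qed
  moreover have "(\<lambda>j. if j = i then 1 else 0) \<in> exponents n 1"
    using assms by (auto simp: exponents_def)
  ultimately show ?thesis
    using poly_on_monomial[of "\<lambda>j. if j = i then 1 else 0" n 1 "1 :: 'a"] by simp
qed

text \<open>A monomial of degree at most \<open>e\<close> in the coordinates of \<open>h\<close> is
  a product of at most \<open>e\<close> functions of degree at most \<open>d\<close>. Applied to the
  evaluation map, this yields the product of degrees in the final bound.\<close>

lemma poly_on_comp:
  assumes F: "poly_on m e F" and h: "\<And>i. i < m \<Longrightarrow> poly_on n d (\<lambda>v. h v $ i)"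
    and dim: "\<And>v. v \<in> carrier_vec n \<Longrightarrow> h v \<in> carrier_vec m"
  shows "poly_on n (d * e) (\<lambda>v. F (h v))"
proof -
  obtain c where
    c: "\<forall>w\<in>carrier_vec m. F w = (\<Sum>\<alpha>\<in>exponents m e. c \<alpha> * (\<Prod>i<m. w $ i ^ \<alpha> i))"
    using F unfolding poly_on_def by blast
  have "poly_on n (d * e) (\<lambda>v. \<Sum>\<alpha>\<in>exponents m e. c \<alpha> * (\<Prod>i<m. h v $ i ^ \<alpha> i))"
  proof (rule poly_on_sum)
    fix \<alpha> assume \<alpha>: "\<alpha> \<in> exponents m e"
    have "poly_on n (0 + (\<Sum>i<m. \<alpha> i * d)) (\<lambda>v. c \<alpha> * (\<Prod>i<m. h v $ i ^ \<alpha> i))"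
      by (intro poly_on_mult poly_on_const poly_on_prod poly_on_power h) auto
    moreover have "0 + (\<Sum>i<m. \<alpha> i * d) \<le> d * e"
      using \<alpha> by (simp add: exponents_def mult.commute flip: sum_distrib_left)
    ultimately show "poly_on n (d * e) (\<lambda>v. c \<alpha> * (\<Prod>i<m. h v $ i ^ \<alpha> i))"
      by (rule poly_on_mono)
  qed
  then show ?thesis
    by (rule poly_on_cong[THEN iffD1, rotated]) (simp add: c dim)
qed

lemma mult_mat_vec_nth:
  assumes "A \<in> carrier_mat m n" "v \<in> carrier_vec n" "i < m"
  shows "(A *\<^sub>v v) $ i = (\<Sum>j<n. A $$ (i, j) * v $ j)"
  using assms by (simp add: scalar_prod_def lessThan_atLeast0)

text \<open>Linear substitutions have coordinates of degree 1, so the degree bound survives. Hence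
  the group acts on the polynomial functions of bounded degree.\<close>

lemma poly_on_linear_comp:
  assumes f: "poly_on n d f" and A: "A \<in> carrier_mat n n"
  shows "poly_on n d (\<lambda>v. f (A *\<^sub>v v))"
proof -
  have "poly_on n 1 (\<lambda>v. (A *\<^sub>v v) $ i)" if "i < n" for i
  proof -
    have "poly_on n (0 + 1) (\<lambda>v. A $$ (i, j) * v $ j)" if "j < n" for j
      using that by (intro poly_on_mult poly_on_const poly_on_coordinate)
    then have "poly_on n 1 (\<lambda>v. \<Sum>j<n. A $$ (i, j) * v $ j)"
      by (intro poly_on_sum) auto
    then show ?thesis
      by (rule poly_on_cong[THEN iffD1, rotated]) (simp add: mult_mat_vec_nth[OF A _ that])
  qed
  from poly_on_comp[OF f this] A show ?thesis by simp
qed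

lemma poly_on_degree_0:
  assumes "poly_on n 0 f" "v \<in> carrier_vec n" "w \<in> carrier_vec n"
  shows "f v = f w"
proof -
  have "exponents n 0 = {\<lambda>_. 0}"
    by (auto simp: exponents_def fun_eq_iff) (metis lessThan_iff not_le)
  then show ?thesis
    using assms unfolding poly_on_def by auto
qed


section \<open>Regular functions\<close>

definition regular_on :: "'a set \<Rightarrow> ('a \<Rightarrow> 'k::field) set \<Rightarrow> ('a \<Rightarrow> 'k) \<Rightarrow> bool" where
  "regular_on X A f \<longleftrightarrow> restrict f X \<in> A"

context
  fixes X :: "'a set" and A :: "('a \<Rightarrow> 'k::field) set"
  assumes A: "function_algebra X A"
begin

lemma regular_on_const: "regular_on X A (\<lambda>x. c)"
  using A by (simp add: regular_on_def function_algebra_def)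

lemma regular_on_add:
  assumes "regular_on X A f" "regular_on X A g"
  shows "regular_on X A (\<lambda>x. f x + g x)"
proof -
  have "(\<lambda>x\<in>X. restrict f X x + restrict g X x) \<in> A"
    using A assms unfolding regular_on_def function_algebra_def by blast
  then show ?thesis
    unfolding regular_on_def by (simp cong: restrict_cong)
qed

lemma regular_on_mult:
  assumes "regular_on X A f" "regular_on X A g"
  shows "regular_on X A (\<lambda>x. f x * g x)"
proof -
  have "(\<lambda>x\<in>X. restrict f X x * restrict g X x) \<in> A"
    using A assms unfolding regular_on_def function_algebra_def by blast
  then show ?thesis
    unfolding regular_on_def by (simp cong: restrict_cong)
qed

lemma regular_on_sum:
  "(\<And>i. i \<in> I \<Longrightarrow> regular_on X A (f i)) \<Longrightarrow> regular_on X A (\<lambda>x. \<Sum>i\<in>I. f i x)"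
  by (induction I rule: infinite_finite_induct) (auto intro: regular_on_const regular_on_add)

lemma regular_on_prod:
  "(\<And>i. i \<in> I \<Longrightarrow> regular_on X A (f i)) \<Longrightarrow> regular_on X A (\<lambda>x. \<Prod>i\<in>I. f i x)"
  by (induction I rule: infinite_finite_induct) (auto intro: regular_on_const regular_on_mult)

lemma regular_on_power: "regular_on X A f \<Longrightarrow> regular_on X A (\<lambda>x. f x ^ k)"
  by (induction k) (auto intro: regular_on_const regular_on_mult)

lemma regular_on_poly_comp:
  assumes f: "poly_on n d f" and h: "\<And>i. i < n \<Longrightarrow> regular_on X A (\<lambda>x. h x $ i)"
    and dim: "\<And>x. x \<in> X \<Longrightarrow> h x \<in> carrier_vec n"
  shows "regular_on X A (\<lambda>x. f (h x))"
proof -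
  obtain c where
    c: "\<forall>v\<in>carrier_vec n. f v = (\<Sum>\<alpha>\<in>exponents n d. c \<alpha> * (\<Prod>i<n. v $ i ^ \<alpha> i))"
    using f unfolding poly_on_def by blast
  have "regular_on X A (\<lambda>x. \<Sum>\<alpha>\<in>exponents n d. c \<alpha> * (\<Prod>i<n. h x $ i ^ \<alpha> i))"
    by (intro regular_on_sum regular_on_mult regular_on_const regular_on_prod regular_on_power h)
       auto
  then show ?thesis
    unfolding regular_on_def by (simp add: c dim cong: restrict_cong)
qed

end

text \<open>The coordinates of \<open>\<rho> x *\<^sub>v u\<close> are linear combinations of
  entries of \<open>\<rho> x\<close>, and a polynomial in regular functions is regular. The matrix
  entries of the quotient representation pull back to functions of this form.\<close>

lemma regular_matrix_coefficient:
  assumes A: "function_algebra (carrier G) (coord_ring G)" and \<rho>: "rational_rep G n \<rho>"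
    and f: "poly_on n d f" and u: "u \<in> carrier_vec n"
  shows "regular_on (carrier G) (coord_ring G) (\<lambda>x. f (\<rho> x *\<^sub>v u))"
proof (rule regular_on_poly_comp[OF A f])
  have \<rho>_carrier: "\<rho> x \<in> carrier_mat n n" if "x \<in> carrier G" for x
    using \<rho> that by (simp add: rational_rep_def)
  then show "\<rho> x *\<^sub>v u \<in> carrier_vec n" if "x \<in> carrier G" for x
    using that u mult_mat_vec_carrier by blast
  fix i assume i: "i < n"
  have "regular_on (carrier G) (coord_ring G) (\<lambda>x. \<rho> x $$ (i, j))" if "j < n" for j
    using \<rho> i that by (simp add: rational_rep_def regular_on_def)
  then have "regular_on (carrier G) (coord_ring G) (\<lambda>x. \<Sum>j<n. \<rho> x $$ (i, j) * u $ j)"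
    by (intro regular_on_sum[OF A] regular_on_mult[OF A] regular_on_const[OF A]) auto
  then show "regular_on (carrier G) (coord_ring G) (\<lambda>x. (\<rho> x *\<^sub>v u) $ i)"
    by (simp add: regular_on_def mult_mat_vec_nth[OF \<rho>_carrier u i] cong: restrict_cong)
qed


section \<open>Interpolation in finite-dimensional function spaces\<close>

text \<open>
  Each point of \<open>U\<close> cuts the dimension by one: if some function of \<open>W\<close> does not vanish at \<open>u\<close>,
  then the functions of \<open>W\<close> vanishing at \<open>u\<close> lie in the span of one function less.
\<close>

lemma interpolation_basis:
  fixes W :: "('a \<Rightarrow> 'k::field) set" and h :: "'i \<Rightarrow> 'a \<Rightarrow> 'k"
  assumes "finite I"
    and "\<And>f g c. f \<in> W \<Longrightarrow> g \<in> W \<Longrightarrow> \<exists>p\<in>W. \<forall>x\<in>X. p x = f x + c * g x"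
    and "\<And>f. f \<in> W \<Longrightarrow> \<exists>c. \<forall>x\<in>X. f x = (\<Sum>i\<in>I. c i * h i x)"
  shows "\<exists>U F. finite U \<and> U \<subseteq> X \<and> (\<forall>u\<in>U. F u \<in> W) \<and>
           (\<forall>u\<in>U. \<forall>w\<in>U. F u w = (if u = w then 1 else 0)) \<and>
           (\<forall>g\<in>W. \<forall>x\<in>X. g x = (\<Sum>u\<in>U. g u * F u x))"
  using assms
proof (induction "card I" arbitrary: I W h)
  case 0
  then have I: "I = {}" by simp
  have "\<forall>g\<in>W. \<forall>x\<in>X. g x = 0" using 0(4) unfolding I by simp
  then show ?case by (intro exI[of _ "{}"]) simp
next
  case (Suc m)
  note lin = Suc.prems(2)
  have lin_sum: "\<exists>p\<in>W. \<forall>x\<in>X. p x = f x + (\<Sum>u\<in>U. c u * F u x)"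
    if "finite U" "f \<in> W" "\<forall>u\<in>U. F u \<in> W" for U f c and F :: "'a \<Rightarrow> 'a \<Rightarrow> 'k"
    using that
  proof (induction U rule: finite_induct)
    case empty
    then show ?case by auto
  next
    case (insert u U)
    then obtain p where "p \<in> W" "\<forall>x\<in>X. p x = f x + (\<Sum>u\<in>U. c u * F u x)" by auto
    with lin[of p "F u" "c u"] insert show ?case by (auto simp: algebra_simps)
  qed
  show ?case
  proof (cases "\<exists>f\<in>W. \<exists>x\<in>X. f x \<noteq> 0")
    case False
    then show ?thesis by (intro exI[of _ "{}"]) auto
  next
    case True
    then obtain f0 u where f0: "f0 \<in> W" "u \<in> X" "f0 u \<noteq> 0" by blast
    \<comment> \<open>Rescaling written in the only operation available:
      \<open>f0 + (1 / f0 u - 1) * f0\<close> is \<open>f0\<close> divided by its value at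
      \<open>u\<close>.\<close>
    obtain f where f: "f \<in> W" "f u = 1"
      using lin[OF f0(1) f0(1), of "1 / f0 u - 1"] f0 by (auto simp: field_simps)
    obtain a where "\<forall>x\<in>X. f x = (\<Sum>i\<in>I. a i * h i x)" using Suc.prems(3)[OF f(1)] by blast
    then have "(\<Sum>i\<in>I. a i * h i u) \<noteq> 0" using f f0 by auto
    then obtain k where k: "k \<in> I" "h k u \<noteq> 0"
      by (metis (mono_tags, lifting) mult_zero_right sum.neutral)
    define J where "J = I - {k}"
    \<comment> \<open>Each generator is corrected by a multiple of \<open>h k\<close> so as to
      vanish at \<open>u\<close>. A function of \<open>W'\<close> keeps its coefficients over
      \<open>J\<close>, because vanishing at \<open>u\<close> determines \<open>c k\<close> from
      them.\<close>
    define h' where "h' i x = h i x - h i u / h k u * h k x" for i x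
    define W' where "W' = {g \<in> W. g u = 0}"
    have "finite J" "m = card J" using Suc k by (auto simp: J_def)
    moreover have "\<exists>p\<in>W'. \<forall>x\<in>X. p x = f x + c * g x" if "f \<in> W'" "g \<in> W'" for f g c
      using lin[of f g c] that f0 by (auto simp: W'_def)
    moreover have "\<exists>c. \<forall>x\<in>X. g x = (\<Sum>i\<in>J. c i * h' i x)" if g: "g \<in> W'" for g
    proof -
      obtain c where c: "\<forall>x\<in>X. g x = (\<Sum>i\<in>I. c i * h i x)"
        using Suc.prems(3)[of g] g by (auto simp: W'_def)
      have split: "(\<Sum>i\<in>I. c i * h i x) = c k * h k x + (\<Sum>i\<in>J. c i * h i x)" for x
        using k Suc.prems(1) by (simp add: J_def sum.remove)
      have "c k * h k u + (\<Sum>i\<in>J. c i * h i u) = 0"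
        using c f0 g split[of u] by (simp add: W'_def)
      then have ck: "c k = - (\<Sum>i\<in>J. c i * h i u) / h k u"
        using k by (simp add: field_simps eq_neg_iff_add_eq_0)
      have "(\<Sum>i\<in>J. c i * h' i x) = (\<Sum>i\<in>J. c i * h i x) + c k * h k x" for x
        unfolding ck h'_def
        by (simp add: sum_subtractf right_diff_distrib sum_distrib_right sum_divide_distrib
            mult.assoc)
      then show ?thesis using c split by (intro exI[of _ c]) simp
    qed
    ultimately obtain U F where UF: "finite U" "U \<subseteq> X" "\<forall>w\<in>U. F w \<in> W'"
        "\<forall>v\<in>U. \<forall>w\<in>U. F v w = (if v = w then 1 else 0)"
        "\<forall>g\<in>W'. \<forall>x\<in>X. g x = (\<Sum>w\<in>U. g w * F w x)"
      using Suc.hyps(1)[of J W' h'] by blast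
    \<comment> \<open>Each \<open>F w\<close> lies in \<open>W'\<close> and so vanishes at
      \<open>u\<close>, whereas \<open>F w w = 1\<close>.\<close>
    have u: "u \<notin> U" using UF by (auto simp: W'_def)
    \<comment> \<open>Subtracting the interpolant of \<open>f\<close> on \<open>U\<close> makes the
      function vanish there; the value 1 at \<open>u\<close> is unaffected, since every
      \<open>F w\<close> is 0 at \<open>u\<close>.\<close>
    obtain f1 where f1: "f1 \<in> W" "\<forall>x\<in>X. f1 x = f x + (\<Sum>w\<in>U. - f w * F w x)"
      using lin_sum[OF UF(1) f(1), of F "\<lambda>w. - f w"] UF(3) by (auto simp: W'_def)
    have f1u: "f1 u = 1" using f1 f0 f UF(3) by (auto simp: W'_def)
    have f1U: "f1 w = 0" if "w \<in> U" for w
    proof -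
      have "(\<Sum>v\<in>U. - f v * F v w) = (\<Sum>v\<in>U. if v = w then - f v else 0)"
        using UF(4) that by (intro sum.cong) auto
      then show ?thesis using f1(2) UF(1,2) that by auto
    qed
    define F' where "F' = F(u := f1)"
    have F'U: "F' w = F w" if "w \<in> U" for w using that u by (auto simp: F'_def)
    have "g x = (\<Sum>w\<in>insert u U. g w * F' w x)" if g: "g \<in> W" "x \<in> X" for g x
    proof -
      \<comment> \<open>Removing the \<open>f1\<close> component of \<open>g\<close> lands in
        \<open>W'\<close>, where the induction hypothesis gives the expansion.\<close>
      obtain p where p: "p \<in> W" "\<forall>x\<in>X. p x = g x + (- g u) * f1 x"
        using lin[OF g(1) f1(1)] by blast
      have "p \<in> W'" using p f0 f1u by (auto simp: W'_def)
      then have "p x = (\<Sum>w\<in>U. p w * F w x)" using UF(5) g by blast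
      also have "\<dots> = (\<Sum>w\<in>U. g w * F' w x)"
        using p f1U UF(2) F'U by (intro sum.cong) (auto simp: subset_iff)
      finally show ?thesis using u UF(1) p g by (simp add: F'_def algebra_simps)
    qed
    moreover have "\<forall>v\<in>insert u U. \<forall>w\<in>insert u U. F' v w = (if v = w then 1 else 0)"
      using UF(3,4) u f1u f1U F'U by (auto simp: F'_def W'_def)
    moreover have "\<forall>v\<in>insert u U. F' v \<in> W" using UF(3) f1 F'U by (auto simp: F'_def W'_def)
    ultimately show ?thesis using UF(1,2) f0
      by (intro exI[of _ "insert u U"] exI[of _ F']) auto
  qed
qed


section \<open>Invariants\<close>

lemma group_closed_subgrp:
  assumes "group G" "subgroup N G"
  shows "group (closed_subgrp G N)"
proof -
  interpret H: group "G\<lparr>carrier := N\<rparr>"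
    by (rule subgroup.subgroup_is_group[OF assms(2,1)])
  show ?thesis
    by (rule groupI)
       (use H.m_closed H.one_closed H.m_assoc H.l_one H.l_inv_ex in
         \<open>auto simp: closed_subgrp_def\<close>)
qed

lemma group_quotient_grp:
  assumes "N \<lhd> G"
  shows "group (quotient_grp G N)"
proof -
  interpret Q: group "G Mod N"
    using assms by (rule normal.factorgroup_is_group)
  show ?thesis
    by (rule groupI)
       (use Q.m_closed Q.one_closed Q.m_assoc Q.l_one Q.l_inv_ex in
         \<open>auto simp: quotient_grp_def\<close>)
qed

lemma rational_rep_closed_subgrp:
  assumes "rational_rep G n \<rho>" "N \<subseteq> carrier G"
  shows "rational_rep (closed_subgrp G N) n \<rho>"
proof -
  have "(\<lambda>x\<in>N. \<rho> x $$ (i, j)) \<in> (\<lambda>f. restrict f N) ` coord_ring G" if "i < n" "j < n" for i j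
  proof (rule image_eqI)
    show "(\<lambda>x\<in>N. \<rho> x $$ (i, j)) = restrict (\<lambda>x\<in>carrier G. \<rho> x $$ (i, j)) N"
      using assms(2) by (auto simp: restrict_def fun_eq_iff)
    show "(\<lambda>x\<in>carrier G. \<rho> x $$ (i, j)) \<in> coord_ring G"
      using assms(1) that by (simp add: rational_rep_def)
  qed
  then show ?thesis
    using assms by (simp add: rational_rep_def closed_subgrp_def subset_iff)
qed

lemma act_invariant_iff:
  assumes G: "group G" and \<rho>: "rational_rep G n \<rho>" and f: "f \<in> extensional (carrier_vec n)"
  shows "(\<forall>x\<in>carrier G. act G n \<rho> x f = f) \<longleftrightarrow>
         (\<forall>x\<in>carrier G. \<forall>v\<in>carrier_vec n. f (\<rho> x *\<^sub>v v) = f v)"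
proof -
  interpret group G by fact
  have "act G n \<rho> x f = f \<longleftrightarrow> (\<forall>v\<in>carrier_vec n. f (\<rho> (inv\<^bsub>G\<^esub> x) *\<^sub>v v) = f v)" for x
    using f by (auto simp: act_def fun_eq_iff extensional_def)
  then show ?thesis by (metis inv_closed inv_inv)
qed

lemma invariants_le_iff:
  assumes "group G" "rational_rep G n \<rho>"
  shows "f \<in> invariants_le G n \<rho> d \<longleftrightarrow> f \<in> extensional (carrier_vec n) \<and> poly_on n d f \<and>
           (\<forall>x\<in>carrier G. \<forall>v\<in>carrier_vec n. f (\<rho> x *\<^sub>v v) = f v)"
  using act_invariant_iff[OF assms, of f]
  by (auto simp: invariants_le_def invariants_def poly_funs_def poly_funs_le_iff)

lemma invariants_eq_Union: "invariants G n \<rho> = (\<Union>d. invariants_le G n \<rho> d)"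
  by (auto simp: invariants_le_def invariants_def poly_funs_def)

text \<open>Passing to a subgroup enlarges the fixed space and also the ring of invariants, and more
  invariants cut out a smaller nullcone.\<close>

lemma fixed_points_diff_nullcone_subgrp:
  assumes G: "group G" and N: "subgroup N G" and \<rho>: "rational_rep G n \<rho>"
  shows "fixed_points G n \<rho> - nullcone G n \<rho> \<subseteq>
         fixed_points (closed_subgrp G N) n \<rho> - nullcone (closed_subgrp G N) n \<rho>"
proof -
  note N_sub = subgroup.subset[OF N]
  have carrier: "carrier (closed_subgrp G N) = N" by (simp add: closed_subgrp_def)
  have "invariants_le G n \<rho> d \<subseteq> invariants_le (closed_subgrp G N) n \<rho> d" for d
    using N_sub
    by (auto simp: subset_iff carrier invariants_le_iff[OF G \<rho>]
        invariants_le_iff[OF group_closed_subgrp[OF G N] rational_rep_closed_subgrp[OF \<rho> N_sub]])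
  then have "invariants G n \<rho> \<subseteq> invariants (closed_subgrp G N) n \<rho>"
    by (auto simp: invariants_eq_Union)
  then show ?thesis
    using N_sub by (auto simp: fixed_points_def nullcone_def zero_const_def carrier)
qed

section \<open>Degree bounds and the values of \<open>delta_rep\<close>\<close>

lemma invariants_le_mono: "d \<le> e \<Longrightarrow> invariants_le G n \<rho> d \<subseteq> invariants_le G n \<rho> e"
  by (auto simp: invariants_le_def poly_funs_le_iff intro: poly_on_mono)

lemma delta_set_mono:
  assumes "delta_set G n \<rho> (invariants_le G n \<rho> d)" "d \<le> e"
  shows "delta_set G n \<rho> (invariants_le G n \<rho> e)"
proof -
  have "zero_const n (invariants_le G n \<rho> d) \<subseteq> zero_const n (invariants_le G n \<rho> e)"
    using invariants_le_mono[OF assms(2), of G n \<rho>] unfolding zero_const_def by blast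
  moreover have "invariants_le G n \<rho> e \<subseteq> invariants G n \<rho>"
    by (simp add: invariants_le_def)
  ultimately show ?thesis
    using assms(1) unfolding delta_set_def by blast
qed

lemma Inf_enat_mem:
  fixes A :: "enat set"
  assumes "A \<noteq> {}"
  shows "Inf A \<in> A"
proof -
  have "\<exists>x. x \<in> A" using assms by blast
  then have "(LEAST x. x \<in> A) \<in> A" by (rule LeastI_ex[of "\<lambda>x. x \<in> A"])
  then show ?thesis
    using assms by (simp only: Inf_enat_def if_False)
qed

text \<open>A finite bound forces the set under the infimum to be nonempty, so the infimum is
  attained; monotonicity carries the property from there up to \<open>d\<close>.\<close>

lemma delta_rep_le_enat_iff:
  "delta_rep G n \<rho> \<le> enat d \<longleftrightarrow> delta_set G n \<rho> (invariants_le G n \<rho> d)"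
proof
  define D where "D = {enat d | d. delta_set G n \<rho> (invariants_le G n \<rho> d)}"
  have delta_rep_eq: "delta_rep G n \<rho> = Inf D" by (simp add: delta_rep_def D_def)
  assume le: "delta_rep G n \<rho> \<le> enat d"
  then have "D \<noteq> {}" by (auto simp: delta_rep_eq Inf_enat_def)
  then have "delta_rep G n \<rho> \<in> D" unfolding delta_rep_eq by (rule Inf_enat_mem)
  then obtain e where "delta_rep G n \<rho> = enat e" "delta_set G n \<rho> (invariants_le G n \<rho> e)"
    unfolding D_def by blast
  with le show "delta_set G n \<rho> (invariants_le G n \<rho> d)"
    by (auto intro: delta_set_mono)
next
  assume "delta_set G n \<rho> (invariants_le G n \<rho> d)"
  then show "delta_rep G n \<rho> \<le> enat d"
    unfolding delta_rep_def by (intro Inf_lower) blast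
qed

lemma delta_rep_le_delta: "rational_rep G n \<rho> \<Longrightarrow> delta_rep G n \<rho> \<le> delta G"
  unfolding delta_def by (rule Sup_upper) blast


text \<open>An invariant of degree 0 is constant, hence zero once its constant term is zero. It
  separates nothing, so the condition can hold only vacuously.\<close>

lemma delta_set_0_iff:
  assumes "group G" "rational_rep G n \<rho>"
  shows "delta_set G n \<rho> (invariants_le G n \<rho> 0) \<longleftrightarrow> fixed_points G n \<rho> \<subseteq> nullcone G n \<rho>"
proof -
  have "f v = 0" if "f \<in> zero_const n (invariants_le G n \<rho> 0)" "v \<in> carrier_vec n" for f v
    using that poly_on_degree_0[of n f v "0\<^sub>v n"]
    by (auto simp: zero_const_def invariants_le_iff[OF assms])
  then show ?thesis
    by (auto simp: delta_set_def fixed_points_def invariants_le_def)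
qed


section \<open>The quotient representation\<close>

lemma not_in_nullcone_of_reductive:
  assumes "geometrically_reductive Q" "rational_rep Q m \<sigma>" "w \<in> fixed_points Q m \<sigma>" "w \<noteq> 0\<^sub>v m"
  shows "w \<in> fixed_points Q m \<sigma> - nullcone Q m \<sigma>"
  using assms by (auto simp: geometrically_reductive_def nullcone_def)

text \<open>In the trivial one-dimensional representation every vector is fixed, and by reductivity
  a nonzero one lies outside the nullcone; constants cannot detect it. This excludes the product
  \<open>\<infinity> * 0 = 0\<close> from the final bound.\<close>

lemma delta_reductive_pos:
  fixes Q :: "('g, 'k::field) alg_grp"
  assumes Q: "group Q" and const: "\<And>c. (\<lambda>x\<in>carrier Q. c) \<in> coord_ring Q"
    and red: "geometrically_reductive Q"
  shows "delta Q \<noteq> 0"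
proof
  assume 0: "delta Q = 0"
  let ?\<sigma> = "\<lambda>_. 1\<^sub>m 1" and ?w = "vec 1 (\<lambda>_. 1 :: 'k)"
  have rep: "rational_rep Q 1 ?\<sigma>"
    using const by (auto simp: rational_rep_def)
  have "?w \<noteq> 0\<^sub>v 1" by (auto dest: arg_cong[where f = "\<lambda>w. w $ 0"])
  then have "?w \<in> fixed_points Q 1 ?\<sigma> - nullcone Q 1 ?\<sigma>"
    by (intro not_in_nullcone_of_reductive[OF red rep]) (auto simp: fixed_points_def)
  moreover have "delta_set Q 1 ?\<sigma> (invariants_le Q 1 ?\<sigma> 0)"
    using delta_rep_le_delta[OF rep] 0 by (simp flip: delta_rep_le_enat_iff add: zero_enat_def)
  ultimately obtain f where "f \<in> zero_const 1 (invariants_le Q 1 ?\<sigma> 0)" "f ?w \<noteq> 0"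
    by (auto simp: delta_set_def)
  moreover from this have "f ?w = f (0\<^sub>v 1)"
    by (intro poly_on_degree_0[of 1])
       (auto simp: zero_const_def simp del: One_nat_def
         dest: invariants_le_iff[OF Q rep, THEN iffD1])
  ultimately show False by (simp add: zero_const_def)
qed

text \<open>The case of finite bounds. The bound \<open>e\<close> has to serve all representations
  of the quotient, since the one it is applied to is built in the proof and depends on
  \<open>\<rho>\<close> and \<open>d\<close>.\<close>

lemma delta_set_quotient:
  fixes G :: "('g, 'k::field) alg_grp"
  assumes G: "linear_algebraic_group G" and N: "N \<lhd> G"
    and red: "geometrically_reductive (quotient_grp G N)"
    and \<rho>: "rational_rep G n \<rho>"
    and dN: "delta_set (closed_subgrp G N) n \<rho> (invariants_le (closed_subgrp G N) n \<rho> d)"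
    and eQ: "\<And>m \<sigma>. rational_rep (quotient_grp G N) m \<sigma> \<Longrightarrow>
               delta_set (quotient_grp G N) m \<sigma> (invariants_le (quotient_grp G N) m \<sigma> e)"
  shows "delta_set G n \<rho> (invariants_le G n \<rho> (d * e))"
proof -
  define Q where "Q = quotient_grp G N"
  define H where "H = closed_subgrp G N"
  interpret normal N G by (rule N)
  have grpG: "group G" by (rule is_group)
  have grpQ: "group Q" using group_quotient_grp[OF N] by (simp add: Q_def)
  have grpH: "group H" unfolding H_def by (rule group_closed_subgrp[OF is_group is_subgroup])
  have \<rho>H: "rational_rep H n \<rho>"
    using rational_rep_closed_subgrp[OF \<rho>] by (simp add: H_def subset)
  have carrierH: "carrier H = N" by (simp add: H_def closed_subgrp_def)
  have carrierQ: "carrier Q = rcosets\<^bsub>G\<^esub> N" by (simp add: Q_def quotient_grp_def FactGroup_def)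
  have alg: "function_algebra (carrier G) (coord_ring G)"
    using G by (simp add: linear_algebraic_group_def affine_variety_def)
  have \<rho>_carrier: "\<rho> x \<in> carrier_mat n n" if "x \<in> carrier G" for x
    using \<rho> that by (simp add: rational_rep_def)
  have \<rho>_vec: "\<rho> x *\<^sub>v v \<in> carrier_vec n" if "x \<in> carrier G" "v \<in> carrier_vec n" for x v
    using \<rho>_carrier that mult_mat_vec_carrier by blast
  have \<rho>_mult: "\<rho> (x \<otimes>\<^bsub>G\<^esub> y) *\<^sub>v v = \<rho> x *\<^sub>v (\<rho> y *\<^sub>v v)"
    if "x \<in> carrier G" "y \<in> carrier G" "v \<in> carrier_vec n" for x y v
    using \<rho> that \<rho>_carrier by (simp add: rational_rep_def assoc_mult_mat_vec[of _ n n _ n])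
  have \<rho>_one: "\<rho> \<one>\<^bsub>G\<^esub> = 1\<^sub>m n" using \<rho> by (simp add: rational_rep_def)

  \<comment> \<open>The \<open>G\<close>-stable space \<open>W\<close> of
    \<open>N\<close>-invariants\<close>
  define W where "W = zero_const n (invariants_le H n \<rho> d)"
  have W_iff: "f \<in> W \<longleftrightarrow> f \<in> extensional (carrier_vec n) \<and> poly_on n d f \<and> f (0\<^sub>v n) = 0 \<and>
      (\<forall>x\<in>N. \<forall>v\<in>carrier_vec n. f (\<rho> x *\<^sub>v v) = f v)" for f
    unfolding W_def zero_const_def using invariants_le_iff[OF grpH \<rho>H, of f d] carrierH by auto
  have W_lin: "\<exists>p\<in>W. \<forall>v\<in>carrier_vec n. p v = f v + c * g v" if "f \<in> W" "g \<in> W" for f g c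
  proof (intro bexI[of _ "\<lambda>v\<in>carrier_vec n. f v + c * g v"])
    have "poly_on n d (\<lambda>v. f v + c * g v)"
      using poly_on_add[of n d f "\<lambda>v. c * g v"] poly_on_mult[OF poly_on_const[of n 0 c], of d g]
        that by (simp add: W_iff)
    then show "(\<lambda>v\<in>carrier_vec n. f v + c * g v) \<in> W"
      unfolding W_iff
      by (intro conjI) (use that \<rho>_vec subset in
          \<open>auto simp: W_iff subset_iff cong: poly_on_cong\<close>)
  qed simp
  have W_span: "\<exists>c. \<forall>v\<in>carrier_vec n. f v = (\<Sum>\<alpha>\<in>exponents n d. c \<alpha> * (\<Prod>i<n. v $ i ^ \<alpha> i))"
    if "f \<in> W" for f
    using that by (simp add: W_iff poly_on_def)
  \<comment> \<open>Translation without an inverse is a right action on \<open>W\<close>, hence a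
    left action on the dual. Normality keeps the translate \<open>N\<close>-invariant:
    \<open>x y = z x\<close> with \<open>z\<close> the conjugate of \<open>y\<close> by
    \<open>x\<close>.\<close>
  have W_act: "(\<lambda>v\<in>carrier_vec n. f (\<rho> x *\<^sub>v v)) \<in> W" if f: "f \<in> W" and x: "x \<in> carrier G" for f x
  proof -
    have "f (\<rho> x *\<^sub>v (\<rho> y *\<^sub>v v)) = f (\<rho> x *\<^sub>v v)" if y: "y \<in> N" and v: "v \<in> carrier_vec n" for y v
    proof -
      let ?z = "x \<otimes>\<^bsub>G\<^esub> y \<otimes>\<^bsub>G\<^esub> inv\<^bsub>G\<^esub> x"
      have z: "?z \<in> N" using x y by (rule inv_op_closed2)
      have yG: "y \<in> carrier G" using y subset by auto
      have "?z \<otimes>\<^bsub>G\<^esub> x = x \<otimes>\<^bsub>G\<^esub> y" using x yG by (simp add: m_assoc)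
      then have "\<rho> x *\<^sub>v (\<rho> y *\<^sub>v v) = \<rho> ?z *\<^sub>v (\<rho> x *\<^sub>v v)"
        using \<rho>_mult[of ?z x v] \<rho>_mult[of x y v] x yG v by simp
      then show ?thesis using f z x v \<rho>_vec by (simp add: W_iff)
    qed
    moreover have "poly_on n d (\<lambda>v. f (\<rho> x *\<^sub>v v))"
      using f x by (intro poly_on_linear_comp \<rho>_carrier) (auto simp: W_iff)
    moreover have "\<rho> x *\<^sub>v 0\<^sub>v n = 0\<^sub>v n"
      using \<rho>_carrier[OF x] by auto
    ultimately show ?thesis
      unfolding W_iff
      by (intro conjI) (use f \<rho>_vec subset in
          \<open>auto simp: W_iff subset_iff cong: poly_on_cong\<close>)
  qed

  \<comment> \<open>A basis of \<open>W\<close> dual to finitely many points\<close>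
  obtain U B where U: "finite U" "U \<subseteq> carrier_vec n" "\<forall>u\<in>U. B u \<in> W"
      "\<forall>u\<in>U. \<forall>w\<in>U. B u w = (if u = w then 1 else 0)"
      "\<forall>g\<in>W. \<forall>v\<in>carrier_vec n. g v = (\<Sum>u\<in>U. g u * B u v)"
    using interpolation_basis[OF finite_exponents W_lin W_span] by blast
  obtain m :: nat and pt where pt: "bij_betw pt {..<m} U"
    using ex_bij_betw_nat_finite[OF U(1)] unfolding lessThan_atLeast0 by blast
  define b where "b i = B (pt i)" for i
  have ptU: "pt i \<in> U" "pt i \<in> carrier_vec n" if "i < m" for i
    using pt that U(2) by (auto simp: bij_betw_def)
  have bW: "b i \<in> W" if "i < m" for i using U(3) ptU that by (simp add: b_def)
  have b_pt: "b i (pt j) = (if i = j then 1 else 0)" if "i < m" "j < m" for i j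
    using U(4) ptU that pt by (auto simp: b_def bij_betw_def inj_on_def)
  have expand: "g v = (\<Sum>j<m. g (pt j) * b j v)" if "g \<in> W" "v \<in> carrier_vec n" for g v
    using U(5) that by (simp add: b_def sum.reindex_bij_betw[OF pt, of "\<lambda>u. g u * B u v"])
  \<comment> \<open>The translate of \<open>b i\<close> lies again in \<open>W\<close>, so its
    coefficients in the basis are its values at the points \<open>pt j\<close>.\<close>
  have expand_act: "b i (\<rho> x *\<^sub>v v) = (\<Sum>j<m. b i (\<rho> x *\<^sub>v pt j) * b j v)"
    if "i < m" "x \<in> carrier G" "v \<in> carrier_vec n" for i x v
    using expand[OF W_act[OF bW[OF that(1)] that(2)] that(3)] that ptU by simp

  \<comment> \<open>\<open>ev v\<close> is evaluation at \<open>v\<close> as an element of \<open>W\<^sup>*\<close>; \<open>\<tau>\<close> and \<open>\<sigma>\<close> are the actions of \<open>G\<close>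
      and \<open>G/N\<close> on \<open>W\<^sup>*\<close>.\<close>
  define ev where "ev v = vec m (\<lambda>i. b i v)" for v
  define \<tau> where "\<tau> x = mat m m (\<lambda>(i, j). b i (\<rho> x *\<^sub>v pt j))" for x
  define \<sigma> where "\<sigma> C = \<tau> (SOME x. x \<in> C)" for C
  have ev_carrier: "ev v \<in> carrier_vec m" for v by (simp add: ev_def)
  have \<tau>_carrier: "\<tau> x \<in> carrier_mat m m" for x by (simp add: \<tau>_def)
  have \<tau>_ev: "\<tau> x *\<^sub>v ev v = ev (\<rho> x *\<^sub>v v)" if "x \<in> carrier G" "v \<in> carrier_vec n" for x v
  proof (rule eq_vecI)
    fix i assume "i < dim_vec (ev (\<rho> x *\<^sub>v v))"
    then have i: "i < m" by (simp add: ev_def)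
    have "(\<tau> x *\<^sub>v ev v) $ i = (\<Sum>j<m. b i (\<rho> x *\<^sub>v pt j) * b j v)"
      unfolding mult_mat_vec_nth[OF \<tau>_carrier ev_carrier i]
      using i by (intro sum.cong) (auto simp: \<tau>_def ev_def)
    then show "(\<tau> x *\<^sub>v ev v) $ i = ev (\<rho> x *\<^sub>v v) $ i"
      using expand_act[OF i that] i by (simp add: ev_def)
  qed (simp add: \<tau>_def ev_def)
  have \<tau>_col: "\<tau> x $$ (i, j) = b i (\<rho> x *\<^sub>v pt j)" if "i < m" "j < m" for x i j
    using that by (simp add: \<tau>_def)
  \<comment> \<open>Multiplicativity is \<open>expand_act\<close> read at the vector
    \<open>\<rho> y *\<^sub>v pt j\<close>.\<close>
  have \<tau>_mult: "\<tau> (x \<otimes>\<^bsub>G\<^esub> y) = \<tau> x * \<tau> y" if "x \<in> carrier G" "y \<in> carrier G" for x y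
  proof (rule eq_matI)
    fix i j assume "i < dim_row (\<tau> x * \<tau> y)" "j < dim_col (\<tau> x * \<tau> y)"
    then have ij: "i < m" "j < m" by (auto simp: \<tau>_def)
    have "\<tau> (x \<otimes>\<^bsub>G\<^esub> y) $$ (i, j) = b i (\<rho> x *\<^sub>v (\<rho> y *\<^sub>v pt j))"
      using ij that ptU by (simp add: \<tau>_col \<rho>_mult)
    also have "\<dots> = (\<Sum>k<m. \<tau> x $$ (i, k) * \<tau> y $$ (k, j))"
      using expand_act[of i x "\<rho> y *\<^sub>v pt j"] ij that ptU \<rho>_vec by (simp add: \<tau>_col)
    also have "\<dots> = (\<tau> x * \<tau> y) $$ (i, j)"
      using ij \<tau>_carrier[of x] \<tau>_carrier[of y] by (simp add: scalar_prod_def lessThan_atLeast0)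
    finally show "\<tau> (x \<otimes>\<^bsub>G\<^esub> y) $$ (i, j) = (\<tau> x * \<tau> y) $$ (i, j)" .
  qed (auto simp: \<tau>_def)
  \<comment> \<open>Since the \<open>b i\<close> are \<open>N\<close>-invariant,
    \<open>\<tau>\<close> is constant on cosets, which makes the choice of representative in
    \<open>\<sigma>\<close> harmless.\<close>
  have \<tau>_N: "\<tau> (y \<otimes>\<^bsub>G\<^esub> x) = \<tau> x" if "y \<in> N" "x \<in> carrier G" for x y
    using that subset ptU bW \<rho>_vec
    by (intro eq_matI) (auto simp: \<tau>_def \<rho>_mult W_iff subset_iff)
  have \<tau>_one: "\<tau> \<one>\<^bsub>G\<^esub> = 1\<^sub>m m"
    using ptU b_pt by (intro eq_matI) (auto simp: \<tau>_def \<rho>_one)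
  have \<sigma>_coset: "\<sigma> (N #>\<^bsub>G\<^esub> x) = \<tau> x" if x: "x \<in> carrier G" for x
  proof -
    have "(SOME y. y \<in> N #>\<^bsub>G\<^esub> x) \<in> N #>\<^bsub>G\<^esub> x"
      using rcos_self[OF x is_subgroup] by (rule someI)
    then obtain y where "y \<in> N" "(SOME y. y \<in> N #>\<^bsub>G\<^esub> x) = y \<otimes>\<^bsub>G\<^esub> x"
      unfolding r_coset_def by auto
    then show ?thesis using \<tau>_N x by (simp add: \<sigma>_def)
  qed
  have cosetE: "\<exists>x\<in>carrier G. C = N #>\<^bsub>G\<^esub> x" if "C \<in> carrier Q" for C
    using that by (auto simp: carrierQ RCOSETS_def)
  have coset_in: "N #>\<^bsub>G\<^esub> x \<in> carrier Q" if "x \<in> carrier G" for x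
    using that by (auto simp: carrierQ RCOSETS_def)
  have rep: "rational_rep Q m \<sigma>"
    unfolding rational_rep_def
  proof (intro conjI ballI allI impI)
    show "\<sigma> C \<in> carrier_mat m m" for C by (simp add: \<sigma>_def \<tau>_carrier)
    have "\<one>\<^bsub>Q\<^esub> = N #>\<^bsub>G\<^esub> \<one>\<^bsub>G\<^esub>"
      using subset by (simp add: Q_def quotient_grp_def FactGroup_def coset_mult_one)
    then show "\<sigma> \<one>\<^bsub>Q\<^esub> = 1\<^sub>m m" by (simp add: \<sigma>_coset \<tau>_one)
  next
    fix C D assume "C \<in> carrier Q" "D \<in> carrier Q"
    then obtain x y where xy: "x \<in> carrier G" "y \<in> carrier G" "C = N #>\<^bsub>G\<^esub> x" "D = N #>\<^bsub>G\<^esub> y"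
      using cosetE by metis
    then have "C \<otimes>\<^bsub>Q\<^esub> D = N #>\<^bsub>G\<^esub> (x \<otimes>\<^bsub>G\<^esub> y)"
      by (simp add: Q_def quotient_grp_def FactGroup_def rcos_sum)
    then show "\<sigma> (C \<otimes>\<^bsub>Q\<^esub> D) = \<sigma> C * \<sigma> D"
      using xy by (simp add: \<sigma>_coset \<tau>_mult)
  next
    fix i j assume ij: "i < m" "j < m"
    have "poly_on n d (b i)" using bW[OF ij(1)] by (simp add: W_iff)
    then have "(\<lambda>x\<in>carrier G. b i (\<rho> x *\<^sub>v pt j)) \<in> coord_ring G"
      using regular_matrix_coefficient[OF alg \<rho>] ptU(2)[OF ij(2)] by (simp add: regular_on_def)
    \<comment> \<open>Regularity on the quotient means regularity of the pullback to
      \<open>G\<close>, and the pullback of this entry is a matrix coefficient of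
      \<open>\<rho>\<close>.\<close>
    moreover have "(\<lambda>x\<in>carrier G. (\<lambda>C\<in>carrier Q. \<sigma> C $$ (i, j)) (N #>\<^bsub>G\<^esub> x))
        = (\<lambda>x\<in>carrier G. b i (\<rho> x *\<^sub>v pt j))"
      using ij by (intro restrict_ext) (simp add: coset_in \<sigma>_coset \<tau>_col)
    ultimately have "(\<lambda>x\<in>carrier G. (\<lambda>C\<in>carrier Q. \<sigma> C $$ (i, j)) (N #>\<^bsub>G\<^esub> x)) \<in> coord_ring G"
      by simp
    then show "(\<lambda>C\<in>carrier Q. \<sigma> C $$ (i, j)) \<in> coord_ring Q"
      by (simp add: Q_def quotient_grp_def)
  qed

  \<comment> \<open>Separating a fixed point by a pulled back invariant\<close>
  show ?thesis
    unfolding delta_set_def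
  proof (intro conjI ballI)
    show "invariants_le G n \<rho> (d * e) \<subseteq> invariants G n \<rho>" by (simp add: invariants_le_def)
  next
    fix v assume v: "v \<in> fixed_points G n \<rho> - nullcone G n \<rho>"
    have v_carrier: "v \<in> carrier_vec n" using v by (simp add: fixed_points_def)
    have v_fixed: "\<rho> x *\<^sub>v v = v" if "x \<in> carrier G" for x
      using v that by (simp add: fixed_points_def)
    have "v \<in> fixed_points H n \<rho> - nullcone H n \<rho>"
      using v fixed_points_diff_nullcone_subgrp[OF is_group is_subgroup \<rho>] by (auto simp: H_def)
    then obtain f where f: "f \<in> W" "f v \<noteq> 0"
      using dN by (auto simp: delta_set_def H_def W_def)
    \<comment> \<open>The functions \<open>b i\<close> span \<open>W\<close>, so they cannot all
      vanish at \<open>v\<close> when \<open>f\<close> does not.\<close>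
    have "\<exists>i<m. b i v \<noteq> 0"
    proof (rule ccontr)
      assume "\<not> (\<exists>i<m. b i v \<noteq> 0)"
      then show False using expand[OF f(1) v_carrier] f(2) by simp
    qed
    then have "ev v \<noteq> 0\<^sub>v m" by (metis ev_def index_vec index_zero_vec(1))
    moreover have "ev v \<in> fixed_points Q m \<sigma>"
      unfolding fixed_points_def
      using ev_carrier cosetE \<sigma>_coset \<tau>_ev v_carrier v_fixed by fastforce
    ultimately have "ev v \<in> fixed_points Q m \<sigma> - nullcone Q m \<sigma>"
      using not_in_nullcone_of_reductive rep red unfolding Q_def by blast
    then obtain F where F: "F \<in> zero_const m (invariants_le Q m \<sigma> e)" "F (ev v) \<noteq> 0"
      using eQ[of m \<sigma>] rep by (auto simp: delta_set_def Q_def)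
    then have F_poly: "poly_on m e F" and F_0: "F (0\<^sub>v m) = 0"
      and F_inv: "\<And>C w. C \<in> carrier Q \<Longrightarrow> w \<in> carrier_vec m \<Longrightarrow> F (\<sigma> C *\<^sub>v w) = F w"
      using invariants_le_iff[OF grpQ rep, of F e] by (auto simp: zero_const_def)
    define p where "p = (\<lambda>u\<in>carrier_vec n. F (ev u))"
    have "poly_on n (d * e) (\<lambda>u. F (ev u))"
    proof (rule poly_on_comp[OF F_poly _ ev_carrier])
      show "poly_on n d (\<lambda>u. ev u $ i)" if "i < m" for i
        using bW[OF that] that by (simp add: ev_def W_iff)
    qed
    then have "poly_on n (d * e) p"
      by (rule poly_on_cong[THEN iffD1, rotated]) (simp add: p_def)
    moreover have "p (\<rho> x *\<^sub>v u) = p u" if "x \<in> carrier G" "u \<in> carrier_vec n" for x u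
    proof -
      have "F (ev (\<rho> x *\<^sub>v u)) = F (\<sigma> (N #>\<^bsub>G\<^esub> x) *\<^sub>v ev u)"
        using that by (simp add: \<sigma>_coset \<tau>_ev)
      then show ?thesis using that \<rho>_vec F_inv[OF coset_in ev_carrier] by (simp add: p_def)
    qed
    ultimately have "p \<in> invariants_le G n \<rho> (d * e)"
      using invariants_le_iff[OF grpG \<rho>, of p "d * e"] by (simp add: p_def)
    \<comment> \<open>Because members of \<open>W\<close> have no constant term, \<open>ev\<close>
      preserves the origin and \<open>p\<close> inherits the zero constant term of
      \<open>F\<close>.\<close>
    moreover have "ev (0\<^sub>v n) = 0\<^sub>v m"
      using bW by (intro eq_vecI) (auto simp: ev_def W_iff)
    ultimately have "p \<in> zero_const n (invariants_le G n \<rho> (d * e))"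
      using F_0 by (simp add: zero_const_def p_def)
    moreover have "p v \<noteq> 0" using F v_carrier by (simp add: p_def)
    ultimately show "\<exists>p\<in>zero_const n (invariants_le G n \<rho> (d * e)). p v \<noteq> 0" by blast
  qed
qed

section \<open>The inequalities in \<open>enat\<close>, with the infinite cases\<close>

theorem proposition2p3:
  fixes G :: "('g, 'k::alg_closed_field) alg_grp" and N :: "'g set"
  assumes "linear_algebraic_group G"
    and "N \<lhd> G"
    and "zariski_closed G N"
    and "geometrically_reductive (quotient_grp G N)"
  shows "(\<forall>n \<rho>. rational_rep G n \<rho> \<longrightarrow>
            delta_rep G n \<rho> \<le> delta_rep (closed_subgrp G N) n \<rho> * delta (quotient_grp G N) \<and>
            delta_rep (closed_subgrp G N) n \<rho> * delta (quotient_grp G N)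
              \<le> delta (closed_subgrp G N) * delta (quotient_grp G N)) \<and>
         delta G \<le> delta (closed_subgrp G N) * delta (quotient_grp G N)"
proof -
  let ?H = "closed_subgrp G N" and ?Q = "quotient_grp G N"
  interpret normal N G by fact
  have "function_algebra (carrier G) (coord_ring G)"
    using assms(1) by (simp add: linear_algebraic_group_def affine_variety_def)
  \<comment> \<open>A constant function on the cosets pulls back to a constant function on
    \<open>G\<close>.\<close>
  then have const: "(\<lambda>C\<in>carrier ?Q. c) \<in> coord_ring ?Q" for c
    using rcosetsI[OF subset]
    by (simp add: function_algebra_def quotient_grp_def FactGroup_def cong: restrict_cong)
  have Q_pos: "delta ?Q \<noteq> 0"
    by (rule delta_reductive_pos[OF group_quotient_grp[OF assms(2)] const assms(4)])
  have *: "delta_rep G n \<rho> \<le> delta_rep ?H n \<rho> * delta ?Q"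
    and **: "delta_rep ?H n \<rho> * delta ?Q \<le> delta ?H * delta ?Q"
    if \<rho>: "rational_rep G n \<rho>" for n \<rho>
  proof -
    have \<rho>H: "rational_rep ?H n \<rho>" by (rule rational_rep_closed_subgrp[OF \<rho> subset])
    then show "delta_rep ?H n \<rho> * delta ?Q \<le> delta ?H * delta ?Q"
      by (intro mult_right_mono delta_rep_le_delta) auto
    show "delta_rep G n \<rho> \<le> delta_rep ?H n \<rho> * delta ?Q"
    proof (cases "delta_rep ?H n \<rho>")
      case infinity
      then have "delta_rep ?H n \<rho> * delta ?Q = \<infinity>"
        using Q_pos by (simp add: imult_is_infinity)
      then show ?thesis by simp
    next
      case (enat d)
      show ?thesis
      proof (cases "delta ?Q")
        case e: (enat e)
        \<comment> \<open>The supremum \<open>e\<close> bounds every representation of the quotient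
          at once, as \<open>delta_set_quotient\<close> requires.\<close>
        have "delta_set ?Q m \<sigma> (invariants_le ?Q m \<sigma> e)" if "rational_rep ?Q m \<sigma>" for m \<sigma>
          using delta_rep_le_delta[OF that] e by (simp flip: delta_rep_le_enat_iff)
        moreover have "delta_set ?H n \<rho> (invariants_le ?H n \<rho> d)"
          using enat by (simp flip: delta_rep_le_enat_iff)
        ultimately have "delta_set G n \<rho> (invariants_le G n \<rho> (d * e))"
          by (intro delta_set_quotient[OF assms(1,2,4) \<rho>])
        then show ?thesis using enat e by (simp add: delta_rep_le_enat_iff)
      next
        case infinity
        show ?thesis
        proof (cases "d = 0")
          case False
          then have "delta_rep ?H n \<rho> * delta ?Q = \<infinity>"
            using enat infinity by (simp add: imult_is_infinity zero_enat_def)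
          then show ?thesis by simp
        next
          case True
          \<comment> \<open>Here the bound is \<open>0 * \<infinity> = 0\<close>.\<close>
          then have "delta_set ?H n \<rho> (invariants_le ?H n \<rho> 0)"
            using enat by (simp flip: delta_rep_le_enat_iff)
          then have "fixed_points ?H n \<rho> \<subseteq> nullcone ?H n \<rho>"
            by (simp add: delta_set_0_iff[OF group_closed_subgrp[OF is_group is_subgroup] \<rho>H])
          then have "fixed_points G n \<rho> \<subseteq> nullcone G n \<rho>"
            using fixed_points_diff_nullcone_subgrp[OF is_group is_subgroup \<rho>] by blast
          then have "delta_rep G n \<rho> \<le> enat 0"
            by (simp add: delta_rep_le_enat_iff delta_set_0_iff[OF is_group \<rho>])
          then show ?thesis by (simp add: zero_enat_def[symmetric])
        qed
      qed
    qed
  qed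
  have "delta G \<le> delta ?H * delta ?Q"
    unfolding delta_def[of G] by (rule Sup_least) (use order_trans[OF * **] in blast)
  with * ** show ?thesis by blast
qed

end
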